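(* Let $k\ge 1$ and, for $n\ge 1$, let $\mathcal{H}_{n,k}$ be the homogenized $(k,k,\dots,k)$-arrangement with $n$ parts, i.e. the arrangement $$\mathcal{H}_{n,k}=\{x_i-x_j=y_i^{(\ell)} \mid 1\le i<j\le n+1,\ 1\le \ell\le k\}$$ in $\mathbb{R}^{nk+n+1}$ with coordinates $x_1,\dots,x_{n+1}$ and $y_i^{(\ell)}$ ($1\le i\le n$, $1\le \ell\le k$). Then $$\sum_{n\geq 1}\chi_{\mathcal{L}(\mathcal{H}_{n,k})}(t)\,u^n = \sum_{n\geq 1} \frac{(t-1)_{n-1}\left((t-1)_{n}\right)^k u^{n}}{\prod_{i=1}^{n}\left(1-i(t-i)^{k}u\right)},$$ where $(x)_n=x(x-1)\cdots(x-(n-1))$.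
   Context: The identity is one of formal power series in $u$ with coefficients in $\mathbb{Z}[t]$; $(x)_0=1$. $\mathcal{L}(\mathcal{H})$ is the intersection poset of the arrangement $\mathcal{H}$: all intersections of hyperplanes of $\mathcal{H}$ (including the whole space), ordered by reverse inclusion. For a finite ranked poset $P$ with bottom $\hat 0$, the characteristic polynomial is $\chi_P(t)=\sum_{X\in P}\mu_P(\hat 0,X)\,t^{\mathrm{rk}(P)-\mathrm{rk}(X)}$, where $\mu_P$ is the Möbius function and $\mathrm{rk}(P)$ is the length of $P$. *)

theory Defs
  imports
    "HOL-Library.FuncSet"
    "HOL-Computational_Algebra.Polynomial"
    "HOL-Computational_Algebra.Formal_Power_Series"
begin

section \<open>Characteristic polynomials of finite ranked posets\<close>

text \<open>
  A poset is given by its order relation \<open>r\<close>, with ground set \<open>Field r\<close>;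
  \<open>(x, y) \<in> r\<close> means that \<open>x\<close> is below \<open>y\<close>.
\<close>

definition bottom :: "'a rel \<Rightarrow> 'a" where
  "bottom r = (THE b. b \<in> Field r \<and> (\<forall>x\<in>Field r. (b, x) \<in> r))"

text \<open>The value 0 for relations that are not finite partial orders only serves totality.\<close>

function mobius :: "'a rel \<Rightarrow> 'a \<Rightarrow> 'a \<Rightarrow> int" where
  "mobius r x y =
     (if \<not> (finite r \<and> Partial_order r) \<or> (x, y) \<notin> r then 0
      else if x = y then 1
      else - (\<Sum>z\<in>{z. (x, z) \<in> r \<and> (z, y) \<in> r \<and> z \<noteq> y}. mobius r x z))"
  by auto
termination
proof (relation "measure (\<lambda>(r, x, y). card (under r y))", simp, clarsimp)
  fix r :: "'a rel" and x y z
  assume fin: "finite r" and po: "Partial_order r"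
    and zy: "(z, y) \<in> r" "z \<noteq> y"
  have "trans r" "antisym r" "refl_on (Field r) r"
    using po by (auto simp: partial_order_on_def preorder_on_def)
  then have "under r z \<subset> under r y"
    using zy by (auto simp: under_def psubset_eq refl_on_def dest: transD antisymD FieldI2)
  moreover have "finite (under r y)"
    by (rule finite_subset[OF _ finite_Domain[OF fin]]) (auto simp: under_def)
  ultimately show "card (under r z) < card (under r y)"
    by (rule psubset_card_mono[rotated])
qed

declare mobius.simps [simp del]

definition poset_length :: "'a rel \<Rightarrow> nat" where
  "poset_length r = Max ((\<lambda>C. card C - 1) ` {C. C \<subseteq> Field r \<and> C \<in> Chains r})"

text \<open>In a ranked poset with bottom, the rank of \<open>x\<close> is the length of the interval from the bottom to \<open>x\<close>.\<close>

definition poset_rank :: "'a rel \<Rightarrow> 'a \<Rightarrow> nat" where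
  "poset_rank r x = poset_length (Restr r (under r x))"

definition poset_char_poly :: "'a rel \<Rightarrow> int poly" where
  "poset_char_poly r =
     (\<Sum>x\<in>Field r. monom (mobius r (bottom r) x) (poset_length r - poset_rank r x))"


section \<open>Intersection posets\<close>

text \<open>
  \<open>V\<close> is the ambient space and \<open>H\<close> the set of hyperplanes.  The empty family of hyperplanes
  contributes \<open>V\<close> itself.
\<close>

definition intersections :: "'a set \<Rightarrow> 'a set set \<Rightarrow> 'a set set" where
  "intersections V H = {V \<inter> \<Inter>S | S. S \<subseteq> H}"

definition intersection_poset :: "'a set \<Rightarrow> 'a set set \<Rightarrow> 'a set rel" where
  "intersection_poset V H =
     {(A, B). A \<in> intersections V H \<and> B \<in> intersections V H \<and> B \<subseteq> A}"

lemma Field_intersection_poset: "Field (intersection_poset V H) = intersections V H"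
  by (auto simp: intersection_poset_def Field_def)

lemma Partial_order_intersection_poset: "Partial_order (intersection_poset V H)"
  unfolding partial_order_on_def preorder_on_def Field_intersection_poset
  by (auto simp: intersection_poset_def refl_on_def trans_def antisym_def)

lemma finite_intersection_poset:
  assumes "finite H"
  shows "finite (intersection_poset V H)"
proof -
  have "intersections V H = (\<lambda>S. V \<inter> \<Inter>S) ` Pow H"
    by (auto simp: intersections_def)
  then have "finite (intersections V H)"
    using assms by simp
  then show ?thesis
    by (intro finite_subset[of "intersection_poset V H" "intersections V H \<times> intersections V H"])
       (auto simp: intersection_poset_def)
qed

lemma bottom_intersection_poset: "bottom (intersection_poset V H) = V"
proof -
  have "V \<in> intersections V H"
    by (auto simp: intersections_def intro: exI[of _ "{}"])
  moreover have "A \<subseteq> V" if "A \<in> intersections V H" for A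
    using that by (auto simp: intersections_def)
  ultimately show ?thesis
    unfolding bottom_def Field_intersection_poset
    by (intro the_equality) (auto simp: intersection_poset_def)
qed


section \<open>The homogenized arrangement\<close>

text \<open>\<open>Xc i\<close> indexes the coordinate $x_i$ and \<open>Yc i l\<close> the coordinate $y_i^{(l)}$.\<close>

datatype coord = Xc nat | Yc nat nat

definition coords :: "nat \<Rightarrow> nat \<Rightarrow> coord set" where
  "coords n k = Xc ` {1..n + 1} \<union> (\<lambda>(i, l). Yc i l) ` ({1..n} \<times> {1..k})"

lemma card_coords: "card (coords n k) = n * k + n + 1"
proof -
  have "card (Xc ` {1..n + 1}) = n + 1"
    by (subst card_image) (auto simp: inj_on_def)
  moreover have "card ((\<lambda>(i, l). Yc i l) ` ({1..n} \<times> {1..k})) = n * k"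
    by (subst card_image) (auto simp: inj_on_def)
  moreover have "Xc ` {1..n + 1} \<inter> (\<lambda>(i, l). Yc i l) ` ({1..n} \<times> {1..k}) = {}"
    by auto
  ultimately show ?thesis
    unfolding coords_def by (subst card_Un_disjoint) auto
qed

definition ambient :: "nat \<Rightarrow> nat \<Rightarrow> (coord \<Rightarrow> real) set" where
  "ambient n k = coords n k \<rightarrow>\<^sub>E UNIV"

definition homogenized_hyperplane ::
    "nat \<Rightarrow> nat \<Rightarrow> nat \<Rightarrow> nat \<Rightarrow> nat \<Rightarrow> (coord \<Rightarrow> real) set" where
  "homogenized_hyperplane n k i j l = {v \<in> ambient n k. v (Xc i) - v (Xc j) = v (Yc i l)}"

definition homogenized_arrangement :: "nat \<Rightarrow> nat \<Rightarrow> (coord \<Rightarrow> real) set set" where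
  "homogenized_arrangement n k =
     {homogenized_hyperplane n k i j l | i j l. 1 \<le> i \<and> i < j \<and> j \<le> n + 1 \<and> 1 \<le> l \<and> l \<le> k}"

lemma finite_homogenized_arrangement: "finite (homogenized_arrangement n k)"
  by (rule finite_subset[of _ "(\<lambda>(i, j, l). homogenized_hyperplane n k i j l) `
        ({..n + 1} \<times> {..n + 1} \<times> {..k})"])
     (force simp: homogenized_arrangement_def)+

definition chi_homogenized :: "nat \<Rightarrow> nat \<Rightarrow> int poly" where
  "chi_homogenized n k = poset_char_poly (intersection_poset (ambient n k) (homogenized_arrangement n k))"


section \<open>The generating function\<close>

definition falling_factorial :: "'a::comm_ring_1 \<Rightarrow> nat \<Rightarrow> 'a" where
  "falling_factorial x n = (\<Prod>i<n. x - of_nat i)"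

text \<open>The indeterminate $t$ of $\mathbf{Z}[t]$.\<close>

abbreviation tvar :: "int poly" where
  "tvar \<equiv> [:0, 1:]"

text \<open>
  Division of formal power series is only available over coefficient types with an
  \<open>inverse\<close> operation, which excludes $\mathbf{Z}[t]$.  A series with constant coefficient 1 is
  nevertheless invertible over any commutative ring; for other series the value is irrelevant.
\<close>

definition fps_recip :: "'a::comm_ring_1 fps \<Rightarrow> 'a fps" where
  "fps_recip f = fps_right_inverse f 1"

lemma fps_recip: "fps_nth f 0 = 1 \<Longrightarrow> f * fps_recip f = 1"
  unfolding fps_recip_def by (rule fps_right_inverse) simp

lemma denominator_nth_0:
  "fps_nth (\<Prod>i\<in>A. 1 - fps_const (c i) * fps_X) 0 = (1 :: 'a :: comm_ring_1)"
  by (induction A rule: infinite_finite_induct) simp_all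

end

theory Submission
  imports Defs
begin

text \<open>
  In the coordinates $x_i$ and $z_i^{(l)} = x_i - y_i^{(l)}$ the hyperplane $x_i - x_j = y_i^{(l)}$ has
  the equation $x_j = z_i^{(l)}$.  The arrangement is therefore the graphic arrangement of the
  bipartite graph with an edge between $x_j$ and $z_i^{(l)}$ for $i < j$.  This graph has two
  components, one of which is the isolated vertex $x_1$, so that $q^2 \chi(q)$ is the number of
  proper colourings of its vertices with $q$ colours (\<open>chi_homogenized_counts_colourings\<close>).

  The link between the characteristic polynomial and colourings is Moebius inversion on the
  intersection poset (\<open>char_poly_counts_complement\<close>).  Colourings with the colours
  $0,\dots,q-1$ are points of the real ambient space, and an intersection of hyperplanes contains
  $q^d$ of them, where $d$ is the number of classes into which its equations divide the vertices.
  Cutting by one more hyperplane either changes nothing or merges two classes, which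
  identifies $d$ with the corank in the poset up to a constant.

  To count proper colourings, choose the colours of $x_{n+1}, x_n, \dots, x_1$ in this order.  If $d$
  colours have been used on $x_{i+1},\dots,x_{n+1}$, each of the $k$ vertices $z_i^{(l)}$ has $q - d$
  possible colours.  The next $x$ repeats a colour in $d$ ways and takes a new one in $q - d$
  ways.  The sums of weights $b(n, d)$ over words of length $n$ with $d$ colours thus satisfy
  \[ b(n+1, d) = (q-d)^k \, (d \, b(n, d) + (q-d+1) \, b(n, d-1)) \]
  (\<open>word_sum_Suc_Suc\<close>).  Staying at $d$ colours for any number of steps produces the factor
  $1/(1 - d(q-d)^k u)$ and passing from $d-1$ to $d$ the factor $(q-d+1)(q-d)^k u$.  Hence
  $\sum_n b(n,d) u^n$ is $q$ times the $d$-th term of the right-hand side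
  (\<open>word_sum_eq_series_coeff\<close>).  The remaining factor $q$ is the colour of $x_1$.
\<close>

section \<open>The characteristic polynomial of an intersection poset\<close>

lemma in_intersection_poset:
  "(A, B) \<in> intersection_poset V H \<longleftrightarrow>
     A \<in> intersections V H \<and> B \<in> intersections V H \<and> B \<subseteq> A"
  by (simp add: intersection_poset_def)

lemma finite_intersections:
  assumes "finite H"
  shows "finite (intersections V H)"
proof -
  have "intersections V H = (\<lambda>S. V \<inter> \<Inter>S) ` Pow H"
    by (auto simp: intersections_def)
  then show ?thesis
    using assms by simp
qed

lemma intersectionsI: "S \<subseteq> H \<Longrightarrow> V \<inter> \<Inter>S \<in> intersections V H"
  by (auto simp: intersections_def)

lemma whole_in_intersections: "V \<in> intersections V H"
  using intersectionsI[of "{}"] by simp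

lemma intersections_subset: "A \<in> intersections V H \<Longrightarrow> A \<subseteq> V"
  by (auto simp: intersections_def)

lemma intersections_Int_Inter:
  assumes "A \<in> intersections V H" "S \<subseteq> H"
  shows "A \<inter> \<Inter>S \<in> intersections V H"
proof -
  from assms(1) obtain T where "T \<subseteq> H" "A = V \<inter> \<Inter>T"
    by (auto simp: intersections_def)
  then show ?thesis
    using assms(2) intersectionsI[of "T \<union> S" H V] by (simp add: Inter_Un_distrib Int_assoc)
qed

text \<open>
  The defining recursion of the Moebius function, in the form in which it selects the whole space.
\<close>

lemma mobius_sum_above:
  assumes "finite H" "X \<in> intersections V H"
  shows "(\<Sum>Z\<in>{Z \<in> intersections V H. X \<subseteq> Z}. mobius (intersection_poset V H) V Z)
           = (if X = V then 1 else 0)"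
proof -
  let ?r = "intersection_poset V H" and ?U = "{Z \<in> intersections V H. X \<subseteq> Z}"
  have fin: "finite ?r" and po: "Partial_order ?r"
    using assms(1) by (rule finite_intersection_poset, intro Partial_order_intersection_poset)
  have VX: "(V, X) \<in> ?r"
    using assms(2) by (simp add: in_intersection_poset whole_in_intersections intersections_subset)
  show ?thesis
  proof (cases "X = V")
    case True
    then have "?U = {V}"
      using whole_in_intersections intersections_subset by blast
    then show ?thesis
      using True VX fin po by (simp add: mobius.simps[of ?r V V])
  next
    case False
    have "{Z. (V, Z) \<in> ?r \<and> (Z, X) \<in> ?r \<and> Z \<noteq> X} = ?U - {X}"
      using assms(2) by (auto simp: in_intersection_poset whole_in_intersections
          dest: intersections_subset)
    then have "mobius ?r V X = - (\<Sum>Z\<in>?U - {X}. mobius ?r V Z)"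
      using False VX fin po by (simp add: mobius.simps[of ?r V X])
    moreover have "(\<Sum>Z\<in>?U. mobius ?r V Z)
        = mobius ?r V X + (\<Sum>Z\<in>?U - {X}. mobius ?r V Z)"
      using assms by (intro sum.remove) (auto simp: finite_intersections)
    ultimately show ?thesis
      using False by simp
  qed
qed

text \<open>
  Moebius inversion by double counting: a point \<open>v\<close> is counted with weight the sum of
  \<open>\<mu>(V, X)\<close> over all \<open>X\<close> that contain the smallest intersection through \<open>v\<close>, and that sum vanishes
  unless this smallest intersection is \<open>V\<close> itself.
\<close>

lemma sum_mobius_card:
  assumes "finite H" "finite C" "C \<subseteq> V" and proper: "\<And>h. h \<in> H \<Longrightarrow> \<not> V \<subseteq> h"
  shows "(\<Sum>X\<in>intersections V H. mobius (intersection_poset V H) V X * int (card (X \<inter> C)))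
           = int (card (C - \<Union>H))"
proof -
  let ?L = "intersections V H" and ?m = "mobius (intersection_poset V H) V"
  have finL: "finite ?L"
    using assms(1) by (rule finite_intersections)
  have point: "(\<Sum>X\<in>?L. if v \<in> X then ?m X else 0) = (if v \<in> \<Union>H then 0 else 1)"
    if "v \<in> C" for v
  proof -
    \<comment> \<open>the smallest intersection through \<open>v\<close>\<close>
    define Xv where "Xv = V \<inter> \<Inter>{h \<in> H. v \<in> h}"
    have Xv: "Xv \<in> ?L"
      unfolding Xv_def by (rule intersectionsI) auto
    have above: "{X \<in> ?L. v \<in> X} = {X \<in> ?L. Xv \<subseteq> X}"
    proof -
      have "v \<in> Xv"
        using that assms(3) by (auto simp: Xv_def)
      moreover have "Xv \<subseteq> X" if "X \<in> ?L" "v \<in> X" for X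
        using that by (auto simp: Xv_def intersections_def)
      ultimately show ?thesis
        by auto
    qed
    have "Xv = V \<longleftrightarrow> v \<notin> \<Union>H"
      using proper by (auto simp: Xv_def)
    moreover have "(\<Sum>X\<in>?L. if v \<in> X then ?m X else 0) = (\<Sum>X\<in>{X \<in> ?L. v \<in> X}. ?m X)"
      using finL by (simp add: sum.inter_filter)
    ultimately show ?thesis
      using mobius_sum_above[OF assms(1) Xv] above by simp
  qed
  have "?m X * int (card (X \<inter> C)) = (\<Sum>v\<in>C. if v \<in> X then ?m X else 0)" for X
    using assms(2) by (simp add: sum.If_cases Int_commute Int_def conj_commute)
  then have "(\<Sum>X\<in>?L. ?m X * int (card (X \<inter> C)))
      = (\<Sum>v\<in>C. \<Sum>X\<in>?L. if v \<in> X then ?m X else 0)"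
    by (simp add: sum.swap[of _ C])
  also have "\<dots> = (\<Sum>v\<in>C. if v \<in> \<Union>H then 0 else 1)"
    by (intro sum.cong refl point)
  also have "\<dots> = int (card (C - \<Union>H))"
  proof -
    have "C - \<Union>H = {v \<in> C. v \<notin> \<Union>H}"
      by auto
    then show ?thesis
      using assms(2) by (simp add: sum.If_cases Collect_neg_eq[symmetric] Int_def del: Union_iff)
  qed
  finally show ?thesis .
qed

text \<open>
  What makes a function \<open>d\<close> on intersections behave like a dimension: a hyperplane
  that does not contain \<open>A\<close> cuts it down by exactly 1.  This one property determines the rank function
  of the intersection poset.
\<close>

definition rank_drop :: "'a set \<Rightarrow> 'a set set \<Rightarrow> ('a set \<Rightarrow> nat) \<Rightarrow> bool" where
  "rank_drop V H d \<longleftrightarrow>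
     (\<forall>A\<in>intersections V H. \<forall>h\<in>H. A \<inter> h \<noteq> A \<longrightarrow> d A = Suc (d (A \<inter> h)))"

text \<open>
  Cutting by the members of \<open>S\<close> one after the other gives a chain in which no value of \<open>d\<close>
  between \<open>d A\<close> and \<open>d (A \<inter> \<Inter>S)\<close> is skipped.  The last conjunct only serves to derive strict
  monotonicity of \<open>d\<close> from the same induction.
\<close>

lemma rank_drop_chain:
  assumes "rank_drop V H d" "finite S" "S \<subseteq> H" "A \<in> intersections V H"
  shows "\<exists>K. finite K \<and> K \<subseteq> intersections V H \<and> A \<in> K \<and> (\<forall>B\<in>K. A \<inter> \<Inter>S \<subseteq> B \<and> B \<subseteq> A)
           \<and> (\<forall>B\<in>K. \<forall>B'\<in>K. B \<subseteq> B' \<or> B' \<subseteq> B) \<and> d A + 1 = d (A \<inter> \<Inter>S) + card K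
           \<and> (A \<inter> \<Inter>S = A \<or> card K > 1)"
  using assms(2,3)
proof (induction S rule: finite_induct)
  case empty
  then show ?case
    using assms(4) by (intro exI[of _ "{A}"]) auto
next
  case (insert h S)
  then obtain K where K: "finite K" "K \<subseteq> intersections V H" "A \<in> K"
    "\<forall>B\<in>K. A \<inter> \<Inter>S \<subseteq> B \<and> B \<subseteq> A" "\<forall>B\<in>K. \<forall>B'\<in>K. B \<subseteq> B' \<or> B' \<subseteq> B"
    "d A + 1 = d (A \<inter> \<Inter>S) + card K" "A \<inter> \<Inter>S = A \<or> card K > 1"
    by auto
  define M where "M = A \<inter> \<Inter>S"
  define N where "N = A \<inter> \<Inter>(insert h S)"
  have N: "N = M \<inter> h"
    by (auto simp: M_def N_def)
  have M_in: "M \<in> intersections V H"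
    using insert.prems assms(4) by (simp add: M_def intersections_Int_Inter)
  have N_in: "N \<in> intersections V H"
    unfolding N_def using insert.prems assms(4) by (intro intersections_Int_Inter)
  show ?case
  proof (cases "M \<inter> h = M")
    case True
    then have "A \<inter> \<Inter>(insert h S) = A \<inter> \<Inter>S"
      using N by (simp add: M_def N_def)
    then show ?thesis
      using K by (intro exI[of _ K]) simp
  next
    case False
    then have drop: "d M = Suc (d N)"
      using assms(1) M_in insert.prems by (auto simp: rank_drop_def N)
    have "N \<subset> M"
      using False N by auto
    have "\<forall>B\<in>K. M \<subseteq> B"
      using K(4) by (simp add: M_def)
    with \<open>N \<subset> M\<close> have new: "N \<notin> K" and below: "\<forall>B\<in>K. N \<subseteq> B"
      by blast+
    show ?thesis
      unfolding N_def[symmetric]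
    proof (intro exI[of _ "insert N K"] conjI)
      show "d A + 1 = d N + card (insert N K)"
        using K(1,6) new drop by (simp add: M_def)
      show "N = A \<or> 1 < card (insert N K)"
        using K(1,3) new by (auto simp: card_gt_0_iff)
      show "\<forall>B\<in>insert N K. N \<subseteq> B \<and> B \<subseteq> A"
        using K(3,4) below by blast
      show "\<forall>B\<in>insert N K. \<forall>B'\<in>insert N K. B \<subseteq> B' \<or> B' \<subseteq> B"
        using K(5) below by blast
    qed (use K N_in in auto)
  qed
qed

lemma rank_drop_strict:
  assumes "rank_drop V H d" "finite H" "A \<in> intersections V H" "B \<in> intersections V H" "B \<subset> A"
  shows "d B < d A"
proof -
  from assms(4) obtain S where S: "S \<subseteq> H" "B = V \<inter> \<Inter>S"
    by (auto simp: intersections_def)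
  then have B: "A \<inter> \<Inter>S = B"
    using assms(5) intersections_subset[OF assms(3)] by auto
  from rank_drop_chain[OF assms(1) finite_subset[OF S(1) assms(2)] S(1) assms(3)]
  obtain K :: "'a set set" where "d A + 1 = d B + card K" "card K > 1"
    unfolding B using assms(5) by auto
  then show ?thesis
    by simp
qed

lemma Restr_under_intersection_poset:
  "Restr (intersection_poset V H) (under (intersection_poset V H) X) =
     {(A, B). A \<in> intersections V H \<and> B \<in> intersections V H \<and> X \<in> intersections V H
        \<and> X \<subseteq> B \<and> B \<subseteq> A}"
  by (auto simp: in_intersection_poset under_def)

text \<open>
  On a chain of intersections that contain \<open>X\<close> the values of \<open>d\<close> are distinct and lie between \<open>d X\<close> and \<open>d V\<close>, which
  bounds its length; the chain of successive cuts attains the bound.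
\<close>

lemma poset_rank_eq:
  assumes "rank_drop V H d" "finite H" "X \<in> intersections V H"
  shows "poset_rank (intersection_poset V H) X = d V - d X"
proof -
  let ?L = "intersections V H" and ?r = "intersection_poset V H"
  define R where "R = Restr ?r (under ?r X)"
  let ?Ch = "{C. C \<subseteq> Field R \<and> C \<in> Chains R}"
  have R: "(A, B) \<in> R \<longleftrightarrow> A \<in> ?L \<and> B \<in> ?L \<and> X \<subseteq> B \<and> B \<subseteq> A" for A B
    unfolding R_def Restr_under_intersection_poset using assms(3) by simp
  have F: "Field R = {A \<in> ?L. X \<subseteq> A}"
    unfolding R_def Restr_under_intersection_poset using assms(3) by (auto simp: Field_def)
  have upper: "card C - 1 \<le> d V - d X" if "C \<in> ?Ch" for C
  proof -
    have C: "A \<in> ?L" "X \<subseteq> A" if "A \<in> C" for A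
      using that \<open>C \<in> ?Ch\<close> F by auto
    have comp: "A \<subseteq> B \<or> B \<subseteq> A" if "A \<in> C" "B \<in> C" for A B
    proof -
      have "(A, B) \<in> R \<or> (B, A) \<in> R"
        using that \<open>C \<in> ?Ch\<close> by (simp add: Chains_def)
      then show ?thesis
        using R by blast
    qed
    have "inj_on d C"
    proof (rule inj_onI, rule ccontr)
      fix A B assume AB: "A \<in> C" "B \<in> C" "d A = d B" "A \<noteq> B"
      then have "A \<subset> B \<or> B \<subset> A"
        using comp by blast
      then show False
        using rank_drop_strict[OF assms(1,2)] C AB by (metis less_irrefl)
    qed
    moreover have "d ` C \<subseteq> {d X..d V}"
    proof clarsimp
      fix A assume "A \<in> C"
      then have "X \<subseteq> A" "A \<subseteq> V" "A \<in> ?L"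
        using C intersections_subset by blast+
      then have "X = A \<or> d X < d A" "A = V \<or> d A < d V"
        using rank_drop_strict[OF assms(1,2)] assms(3) whole_in_intersections[of V H] by blast+
      then show "d X \<le> d A \<and> d A \<le> d V"
        by auto
    qed
    ultimately have "card C \<le> card {d X..d V}"
      by (metis card_inj_on_le finite_atLeastAtMost)
    then show ?thesis
      by simp
  qed
  have attained: "\<exists>C\<in>?Ch. card C - 1 = d V - d X"
  proof -
    from assms(3) obtain S where S: "S \<subseteq> H" "X = V \<inter> \<Inter>S"
      by (auto simp: intersections_def)
    from rank_drop_chain[OF assms(1) finite_subset[OF S(1) assms(2)] S(1)
        whole_in_intersections]
    obtain K where K: "K \<subseteq> ?L" "\<forall>B\<in>K. X \<subseteq> B" "\<forall>B\<in>K. \<forall>B'\<in>K. B \<subseteq> B' \<or> B' \<subseteq> B"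
      "d V + 1 = d X + card K"
      unfolding S(2)[symmetric] by auto
    then have "K \<subseteq> Field R" "\<forall>A\<in>K. \<forall>B\<in>K. (A, B) \<in> R \<or> (B, A) \<in> R"
      unfolding F R by blast+
    then have "K \<in> ?Ch"
      by (simp add: Chains_def)
    moreover have "card K - 1 = d V - d X"
      using K(4) by simp
    ultimately show ?thesis
      by blast
  qed
  have "?Ch \<subseteq> Pow ?L"
    using F by auto
  then have "finite ?Ch"
    using finite_intersections[OF assms(2)] by (meson finite_Pow_iff finite_subset)
  then show ?thesis
    unfolding poset_rank_def poset_length_def R_def[symmetric]
  proof (intro Max_eqI)
    show "d V - d X \<in> (\<lambda>C. card C - 1) ` ?Ch"
      using attained by (elim bexE) (rule image_eqI[OF sym])
  qed (use upper in auto)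
qed

text \<open>
  The intersection of all hyperplanes is the top element, so the length of the poset is its rank.
\<close>

lemma poset_length_eq:
  assumes "rank_drop V H d" "finite H"
  shows "poset_length (intersection_poset V H) = d V - d (V \<inter> \<Inter>H)"
proof -
  let ?M = "V \<inter> \<Inter>H" and ?r = "intersection_poset V H"
  have "Restr ?r (under ?r ?M) = ?r"
    unfolding Restr_under_intersection_poset
    by (auto simp: intersection_poset_def intersectionsI) (auto simp: intersections_def)
  then show ?thesis
    using poset_rank_eq[OF assms intersectionsI[OF order_refl]] by (simp add: poset_rank_def)
qed

text \<open>
  A finite set \<open>C\<close> that meets every intersection \<open>A\<close> in \<open>q ^ d A\<close> points plays the part
  of the points of the arrangement over a field with \<open>q\<close> elements.  The power of \<open>q\<close> on
  the left compensates that the exponents of the characteristic polynomial are relative to the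
  dimension of the smallest intersection.
\<close>

lemma char_poly_counts_complement:
  assumes "rank_drop V H d" "finite H" and "\<And>h. h \<in> H \<Longrightarrow> \<not> V \<subseteq> h"
    and "finite C" "C \<subseteq> V"
    and card: "\<And>A. A \<in> intersections V H \<Longrightarrow> card (A \<inter> C) = q ^ d A"
  shows "int q ^ d (V \<inter> \<Inter>H) * poly (poset_char_poly (intersection_poset V H)) (int q)
           = int (card (C - \<Union>H))"
proof -
  let ?L = "intersections V H" and ?r = "intersection_poset V H" and ?M = "V \<inter> \<Inter>H"
  have M: "?M \<in> ?L"
    by (rule intersectionsI) simp
  have mono: "d ?M \<le> d X \<and> d X \<le> d V" if "X \<in> ?L" for X
  proof -
    have "X \<subseteq> V" "?M \<subseteq> X"
      using that by (auto simp: intersections_def)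
    then have "X = V \<or> d X < d V" "?M = X \<or> d ?M < d X"
      using rank_drop_strict[OF assms(1,2)] that whole_in_intersections[of V H] M by blast+
    then show ?thesis
      by auto
  qed
  have corank: "poset_length ?r - poset_rank ?r X = d X - d ?M" if "X \<in> ?L" for X
    using mono[OF that] mono[OF M] by (simp add: poset_length_eq[OF assms(1,2)]
        poset_rank_eq[OF assms(1,2) that])
  have "int q ^ d ?M * poly (poset_char_poly ?r) (int q)
      = (\<Sum>X\<in>?L. mobius ?r V X * (int q ^ d ?M * int q ^ (d X - d ?M)))"
    unfolding poset_char_poly_def bottom_intersection_poset Field_intersection_poset
    by (simp add: poly_sum poly_monom sum_distrib_left corank algebra_simps)
  also have "\<dots> = (\<Sum>X\<in>?L. mobius ?r V X * int (card (X \<inter> C)))"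
    by (intro sum.cong refl) (use mono in \<open>simp add: card flip: power_add\<close>)
  also have "\<dots> = int (card (C - \<Union>H))"
    by (rule sum_mobius_card) (use assms in auto)
  finally show ?thesis .
qed

section \<open>Equations between coordinates\<close>

text \<open>
  A system of equations between coordinates is encoded by an idempotent map \<open>\<rho>\<close>
  that sends each coordinate to a representative of its class: the solutions are the points
  that factor through \<open>\<rho>\<close>, and the number of classes is the cardinality of the image.
\<close>

definition retraction_on :: "'a set \<Rightarrow> ('a \<Rightarrow> 'a) \<Rightarrow> bool" where
  "retraction_on U \<rho> \<longleftrightarrow> (\<forall>a\<in>U. \<rho> a \<in> U \<and> \<rho> (\<rho> a) = \<rho> a)"

definition factors_through :: "'a set \<Rightarrow> ('a \<Rightarrow> 'a) \<Rightarrow> ('a \<Rightarrow> 'b) \<Rightarrow> bool" where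
  "factors_through U \<rho> w \<longleftrightarrow> (\<forall>a\<in>U. w a = w (\<rho> a))"

text \<open>
  Adding the equation between \<open>a\<close> and \<open>b\<close> moves the class of \<open>a\<close> to the representative of \<open>b\<close>.
\<close>

definition merge :: "('a \<Rightarrow> 'a) \<Rightarrow> 'a \<Rightarrow> 'a \<Rightarrow> 'a \<Rightarrow> 'a" where
  "merge \<rho> a b = (\<lambda>x. if \<rho> x = \<rho> a then \<rho> b else \<rho> x)"

lemma retraction_on_merge:
  "retraction_on U \<rho> \<Longrightarrow> b \<in> U \<Longrightarrow> retraction_on U (merge \<rho> a b)"
  by (auto simp: retraction_on_def merge_def)

lemma factors_through_merge:
  assumes "retraction_on U \<rho>" "a \<in> U" "b \<in> U"
  shows "factors_through U (merge \<rho> a b) w \<longleftrightarrow> factors_through U \<rho> w \<and> w a = w b"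
proof
  assume *: "factors_through U (merge \<rho> a b) w"
  have ra: "\<rho> a \<in> U" "\<rho> (\<rho> a) = \<rho> a" "\<rho> b \<in> U" "\<rho> (\<rho> b) = \<rho> b"
    using assms by (auto simp: retraction_on_def)
  have 1: "w x = w (merge \<rho> a b x)" if "x \<in> U" for x
    using * that by (simp add: factors_through_def)
  have ab: "w a = w (\<rho> b)" "w (\<rho> a) = w (\<rho> b)" "w b = w (\<rho> b)"
    using 1[OF assms(2)] 1[OF ra(1)] 1[OF assms(3)] ra by (auto simp: merge_def split: if_splits)
  have "w x = w (\<rho> x)" if "x \<in> U" for x
    using 1[OF that] ab by (auto simp: merge_def split: if_splits)
  then show "factors_through U \<rho> w \<and> w a = w b"
    using ab by (simp add: factors_through_def)
next
  assume *: "factors_through U \<rho> w \<and> w a = w b"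
  then have "w x = w (\<rho> x)" if "x \<in> U" for x
    using that by (simp add: factors_through_def)
  then show "factors_through U (merge \<rho> a b) w"
    using * assms unfolding factors_through_def merge_def by (metis (full_types))
qed

lemma card_image_merge:
  assumes "finite U" "retraction_on U \<rho>" "a \<in> U" "b \<in> U" "\<rho> a \<noteq> \<rho> b"
  shows "card (\<rho> ` U) = Suc (card (merge \<rho> a b ` U))"
proof -
  have "merge \<rho> a b ` U = \<rho> ` U - {\<rho> a}"
    using assms by (auto simp: merge_def image_iff)
  then show ?thesis
    using assms by (metis card.remove finite_imageI imageI)
qed

lemma card_factoring_functions:
  assumes "finite U" "retraction_on U \<rho>"
  shows "card {w \<in> U \<rightarrow>\<^sub>E Q. factors_through U \<rho> w} = card Q ^ card (\<rho> ` U)"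
proof -
  let ?f = "\<lambda>w. restrict w (\<rho> ` U)" and ?g = "\<lambda>u. \<lambda>a\<in>U. u (\<rho> a)"
  have \<rho>: "\<rho> a \<in> U" "\<rho> (\<rho> a) = \<rho> a" if "a \<in> U" for a
    using assms that by (auto simp: retraction_on_def)
  have "bij_betw ?f {w \<in> U \<rightarrow>\<^sub>E Q. factors_through U \<rho> w} (\<rho> ` U \<rightarrow>\<^sub>E Q)"
  proof (rule bij_betw_byWitness[where f' = ?g])
    show "\<forall>w\<in>{w \<in> U \<rightarrow>\<^sub>E Q. factors_through U \<rho> w}. ?g (?f w) = w"
      by (auto simp: factors_through_def fun_eq_iff PiE_def extensional_def)
    show "\<forall>u\<in>\<rho> ` U \<rightarrow>\<^sub>E Q. ?f (?g u) = u"
      using \<rho> by (auto simp: fun_eq_iff PiE_def extensional_def restrict_def)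
    show "?f ` {w \<in> U \<rightarrow>\<^sub>E Q. factors_through U \<rho> w} \<subseteq> \<rho> ` U \<rightarrow>\<^sub>E Q"
      using \<rho> by auto
    show "?g ` (\<rho> ` U \<rightarrow>\<^sub>E Q) \<subseteq> {w \<in> U \<rightarrow>\<^sub>E Q. factors_through U \<rho> w}"
      using \<rho> by (auto simp: factors_through_def)
  qed
  then show ?thesis
    using assms(1) by (simp add: bij_betw_same_card card_funcsetE)
qed

section \<open>The arrangement as a graphic arrangement\<close>

text \<open>
  The coordinates $x_i$ and $z_i^{(l)} = x_i - y_i^{(l)}$.  In them the hyperplane
  $x_i - x_j = y_i^{(l)}$ becomes $x_j = z_i^{(l)}$, so the arrangement turns into a graphic one.
  The change of coordinates is an involution of the ambient space.
\<close>

definition shear :: "nat \<Rightarrow> nat \<Rightarrow> (coord \<Rightarrow> real) \<Rightarrow> coord \<Rightarrow> real" where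
  "shear n k v = (\<lambda>c\<in>coords n k. case c of Xc i \<Rightarrow> v (Xc i) | Yc i l \<Rightarrow> v (Xc i) - v (Yc i l))"

lemma finite_coords: "finite (coords n k)"
  by (simp add: coords_def)

lemma Xc_in_coords [simp]: "Xc i \<in> coords n k \<longleftrightarrow> 1 \<le> i \<and> i \<le> n + 1"
  by (auto simp: coords_def)

lemma Yc_in_coords [simp]: "Yc i l \<in> coords n k \<longleftrightarrow> 1 \<le> i \<and> i \<le> n \<and> 1 \<le> l \<and> l \<le> k"
  by (force simp: coords_def)

lemma shear_in_ambient: "shear n k v \<in> ambient n k"
  by (simp add: shear_def ambient_def)

lemma shear_shear:
  assumes "v \<in> ambient n k"
  shows "shear n k (shear n k v) = v"
proof
  fix c show "shear n k (shear n k v) c = v c"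
    using assms by (cases c) (auto simp: shear_def ambient_def PiE_def extensional_def)
qed

lemma homogenized_hyperplane_eq:
  assumes "1 \<le> i" "i < j" "j \<le> n + 1" "1 \<le> l" "l \<le> k"
  shows "homogenized_hyperplane n k i j l
           = {v \<in> ambient n k. shear n k v (Xc j) = shear n k v (Yc i l)}"
  using assms by (auto simp: homogenized_hyperplane_def shear_def)

definition flat :: "nat \<Rightarrow> nat \<Rightarrow> (coord \<Rightarrow> coord) \<Rightarrow> (coord \<Rightarrow> real) set" where
  "flat n k \<rho> = {v \<in> ambient n k. factors_through (coords n k) \<rho> (shear n k v)}"

lemma flat_Int_hyperplane:
  assumes "retraction_on (coords n k) \<rho>" "1 \<le> i" "i < j" "j \<le> n + 1" "1 \<le> l" "l \<le> k"
  shows "flat n k \<rho> \<inter> homogenized_hyperplane n k i j l = flat n k (merge \<rho> (Xc j) (Yc i l))"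
  using assms by (auto simp: flat_def homogenized_hyperplane_eq factors_through_merge)

lemma intersection_is_flat:
  assumes "A \<in> intersections (ambient n k) (homogenized_arrangement n k)"
  shows "\<exists>\<rho>. retraction_on (coords n k) \<rho> \<and> A = flat n k \<rho>"
proof -
  from assms obtain S where S: "S \<subseteq> homogenized_arrangement n k" "A = ambient n k \<inter> \<Inter>S"
    by (auto simp: intersections_def)
  have "finite S"
    using S(1) finite_homogenized_arrangement by (rule finite_subset)
  then have "\<exists>\<rho>. retraction_on (coords n k) \<rho> \<and> ambient n k \<inter> \<Inter>S = flat n k \<rho>"
    using S(1)
  proof (induction S rule: finite_induct)
    case empty
    show ?case
      by (intro exI[of _ id]) (auto simp: retraction_on_def flat_def factors_through_def)
  next
    case (insert h S)
    then obtain \<rho> where \<rho>: "retraction_on (coords n k) \<rho>" "ambient n k \<inter> \<Inter>S = flat n k \<rho>"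
      by auto
    from insert.prems obtain i j l where h: "h = homogenized_hyperplane n k i j l"
      and ijl: "1 \<le> i" "i < j" "j \<le> n + 1" "1 \<le> l" "l \<le> k"
      by (auto simp: homogenized_arrangement_def)
    have "ambient n k \<inter> \<Inter>(insert h S) = (ambient n k \<inter> \<Inter>S) \<inter> h"
      by auto
    also have "\<dots> = flat n k (merge \<rho> (Xc j) (Yc i l))"
      unfolding \<rho>(2) h using \<rho>(1) ijl by (rule flat_Int_hyperplane)
    finally show ?case
      using \<rho>(1) ijl by (metis retraction_on_merge Yc_in_coords less_Suc_eq_le Suc_eq_plus1
          order_less_le_trans)
  qed
  then show ?thesis
    using S(2) by simp
qed

text \<open>
  The points with all sheared coordinates in $\{0,\dots,q-1\}$, i.e. the colourings of the
  vertices of the graph with \<open>q\<close> colours.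
\<close>

definition grid :: "nat \<Rightarrow> nat \<Rightarrow> nat \<Rightarrow> (coord \<Rightarrow> real) set" where
  "grid n k q = {v \<in> ambient n k. shear n k v \<in> coords n k \<rightarrow>\<^sub>E real ` {..<q}}"

text \<open>
  Counting grid points is counting colourings of the vertex set \<open>coords n k\<close>.
\<close>

lemma card_shear_preimage:
  "card {v \<in> grid n k q. P (shear n k v)} = card {w \<in> coords n k \<rightarrow>\<^sub>E real ` {..<q}. P w}"
proof -
  define W where "W = (coords n k \<rightarrow>\<^sub>E real ` {..<q})"
  have grid: "v \<in> grid n k q \<longleftrightarrow> v \<in> ambient n k \<and> shear n k v \<in> W" for v
    by (simp add: grid_def W_def)
  have amb: "w \<in> ambient n k" if "w \<in> W" for w
    using that by (auto simp: ambient_def W_def)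
  have "bij_betw (shear n k) {v \<in> grid n k q. P (shear n k v)} {w \<in> W. P w}"
    by (rule bij_betw_byWitness[where f' = "shear n k"])
       (auto simp: grid shear_shear shear_in_ambient amb)
  then show ?thesis
    unfolding W_def by (rule bij_betw_same_card)
qed

lemma finite_grid: "finite (grid n k q)"
proof -
  have "grid n k q \<subseteq> shear n k ` (coords n k \<rightarrow>\<^sub>E real ` {..<q})"
  proof
    fix v assume "v \<in> grid n k q"
    then have "v = shear n k (shear n k v)" "shear n k v \<in> coords n k \<rightarrow>\<^sub>E real ` {..<q}"
      by (auto simp: grid_def shear_shear)
    then show "v \<in> shear n k ` (coords n k \<rightarrow>\<^sub>E real ` {..<q})"
      by (rule image_eqI)
  qed
  then show ?thesis
    by (rule finite_subset) (simp add: finite_coords finite_PiE)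
qed

lemma card_flat_Int_grid:
  assumes "retraction_on (coords n k) \<rho>"
  shows "card (flat n k \<rho> \<inter> grid n k q) = q ^ card (\<rho> ` coords n k)"
proof -
  have "flat n k \<rho> \<inter> grid n k q = {v \<in> grid n k q. factors_through (coords n k) \<rho> (shear n k v)}"
    by (auto simp: flat_def grid_def)
  then show ?thesis
    using assms by (simp add: card_shear_preimage card_factoring_functions finite_coords card_image)
qed

text \<open>
  A flat with \<open>m\<close> free coordinates has \<open>q ^ m\<close> grid points for every \<open>q\<close>; already \<open>q = 2\<close>
  determines \<open>m\<close>, so that the dimension can be read off from the set itself rather than from a
  description of it by equations.
\<close>

definition flat_dim :: "nat \<Rightarrow> nat \<Rightarrow> (coord \<Rightarrow> real) set \<Rightarrow> nat" where
  "flat_dim n k A = (THE m. card (A \<inter> grid n k 2) = 2 ^ m)"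

lemma flat_dim_eq:
  assumes "card (A \<inter> grid n k 2) = 2 ^ m"
  shows "flat_dim n k A = m"
  unfolding flat_dim_def using assms by (intro the_equality) auto

lemma card_intersection_Int_grid:
  assumes "A \<in> intersections (ambient n k) (homogenized_arrangement n k)"
  shows "card (A \<inter> grid n k q) = q ^ flat_dim n k A"
proof -
  from intersection_is_flat[OF assms] obtain \<rho> where
    "retraction_on (coords n k) \<rho>" "A = flat n k \<rho>"
    by blast
  then show ?thesis
    using card_flat_Int_grid flat_dim_eq by metis
qed

text \<open>
  An equation that does not hold on a flat joins two different classes of coordinates.
\<close>

lemma rank_drop_homogenized:
  "rank_drop (ambient n k) (homogenized_arrangement n k) (flat_dim n k)"
  unfolding rank_drop_def
proof (intro ballI impI)
  fix A h
  assume A: "A \<in> intersections (ambient n k) (homogenized_arrangement n k)"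
    and "h \<in> homogenized_arrangement n k" and ne: "A \<inter> h \<noteq> A"
  then obtain i j l where h: "h = homogenized_hyperplane n k i j l"
    and ijl: "1 \<le> i" "i < j" "j \<le> n + 1" "1 \<le> l" "l \<le> k"
    by (auto simp: homogenized_arrangement_def)
  from intersection_is_flat[OF A] obtain \<rho> where
    \<rho>: "retraction_on (coords n k) \<rho>" "A = flat n k \<rho>"
    by blast
  let ?m = "merge \<rho> (Xc j) (Yc i l)"
  have Ah: "A \<inter> h = flat n k ?m"
    unfolding \<rho>(2) h using \<rho>(1) ijl by (rule flat_Int_hyperplane)
  have coords: "Xc j \<in> coords n k" "Yc i l \<in> coords n k"
    using ijl by auto
  have dims: "flat_dim n k A = card (\<rho> ` coords n k)" "flat_dim n k (A \<inter> h) = card (?m ` coords n k)"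
    unfolding Ah unfolding \<rho>(2)
    using \<rho>(1) coords by (auto intro!: flat_dim_eq card_flat_Int_grid retraction_on_merge)
  have "\<rho> (Xc j) \<noteq> \<rho> (Yc i l)"
  proof
    assume "\<rho> (Xc j) = \<rho> (Yc i l)"
    then have "?m = \<rho>"
      by (auto simp: merge_def)
    then show False
      using ne Ah \<rho>(2) by simp
  qed
  then show "flat_dim n k A = Suc (flat_dim n k (A \<inter> h))"
    unfolding dims using card_image_merge[OF finite_coords \<rho>(1) coords] by simp
qed

lemma hyperplane_proper:
  assumes "h \<in> homogenized_arrangement n k"
  shows "\<not> ambient n k \<subseteq> h"
proof -
  from assms obtain i j l where h: "h = homogenized_hyperplane n k i j l"
    and ijl: "1 \<le> i" "i < j" "j \<le> n + 1" "1 \<le> l" "l \<le> k"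
    by (auto simp: homogenized_arrangement_def)
  let ?v = "\<lambda>c\<in>coords n k. if c = Xc j then 1 else 0 :: real"
  have "?v \<in> ambient n k" "?v \<notin> h"
    using ijl by (auto simp: ambient_def h homogenized_hyperplane_def)
  then show ?thesis
    by blast
qed

text \<open>
  The vertex $x_1$ of the graph is isolated, and all other vertices form one component: every
  $z_i^{(l)}$ is adjacent to $x_{n+1}$, and $z_1^{(1)}$ is adjacent to $x_2,\dots,x_{n+1}$.
  Both \<open>n \<ge> 1\<close> and \<open>k \<ge> 1\<close> matter here, to have such a vertex $z_1^{(1)}$.
\<close>

lemma flat_dim_center:
  assumes "n \<ge> 1" "k \<ge> 1"
  shows "flat_dim n k (ambient n k \<inter> \<Inter>(homogenized_arrangement n k)) = 2"
proof -
  \<comment> \<open>the representatives of the two components\<close>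
  let ?\<rho> = "\<lambda>c. if c = Xc 1 then Xc 1 else Xc (n + 1)"
  have "ambient n k \<inter> \<Inter>(homogenized_arrangement n k) = flat n k ?\<rho>"
  proof (rule set_eqI)
    fix v
    define w where "w = shear n k v"
    have "(\<forall>i j l. 1 \<le> i \<and> i < j \<and> j \<le> n + 1 \<and> 1 \<le> l \<and> l \<le> k \<longrightarrow> w (Xc j) = w (Yc i l))
        \<longleftrightarrow> factors_through (coords n k) ?\<rho> w" (is "?E \<longleftrightarrow> _")
    proof
      assume E: ?E
      have Y: "w (Yc i l) = w (Xc (n + 1))" if "1 \<le> i" "i \<le> n" "1 \<le> l" "l \<le> k" for i l
        using E[rule_format, of i "n + 1" l] that by simp
      have X: "w (Xc j) = w (Xc (n + 1))" if "1 < j" "j \<le> n + 1" for j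
        using E[rule_format, of 1 j 1] Y[of 1 1] that assms by simp
      show "factors_through (coords n k) ?\<rho> w"
        unfolding factors_through_def
      proof
        fix c assume "c \<in> coords n k"
        then show "w c = w (if c = Xc 1 then Xc 1 else Xc (n + 1))"
        proof (cases c)
          case (Xc j)
          with \<open>c \<in> coords n k\<close> show ?thesis
            using X[of j] by (cases "j = 1") simp_all
        next
          case (Yc i l)
          with \<open>c \<in> coords n k\<close> show ?thesis
            using Y[of i l] by simp
        qed
      qed
    next
      assume F: "factors_through (coords n k) ?\<rho> w"
      show ?E
      proof (intro allI impI)
        fix i j l assume "1 \<le> i \<and> i < j \<and> j \<le> n + 1 \<and> 1 \<le> l \<and> l \<le> k"
        then show "w (Xc j) = w (Yc i l)"
          using bspec[OF F[unfolded factors_through_def], of "Xc j"]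
            bspec[OF F[unfolded factors_through_def], of "Yc i l"] by simp
      qed
    qed
    moreover have "v \<in> ambient n k \<inter> \<Inter>(homogenized_arrangement n k) \<longleftrightarrow> v \<in> ambient n k \<and>
        (\<forall>i j l. 1 \<le> i \<and> i < j \<and> j \<le> n + 1 \<and> 1 \<le> l \<and> l \<le> k \<longrightarrow> v \<in> homogenized_hyperplane n k i j l)"
      by (auto simp: homogenized_arrangement_def)
    ultimately show "v \<in> ambient n k \<inter> \<Inter>(homogenized_arrangement n k) \<longleftrightarrow> v \<in> flat n k ?\<rho>"
      by (auto simp: flat_def homogenized_hyperplane_eq w_def)
  qed
  moreover have "retraction_on (coords n k) ?\<rho>"
    by (auto simp: retraction_on_def)
  moreover have "?\<rho> ` coords n k = {Xc 1, Xc (n + 1)}"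
  proof
    have "Xc 1 \<in> coords n k" "Xc (n + 1) \<in> coords n k"
      by simp_all
    then have "{?\<rho> (Xc 1), ?\<rho> (Xc (n + 1))} \<subseteq> ?\<rho> ` coords n k"
      by blast
    then show "{Xc 1, Xc (n + 1)} \<subseteq> ?\<rho> ` coords n k"
      by (simp split: if_splits)
  qed auto
  ultimately show ?thesis
    using assms by (intro flat_dim_eq) (simp add: card_flat_Int_grid)
qed

definition proper_colourings :: "nat \<Rightarrow> nat \<Rightarrow> 'a set \<Rightarrow> (coord \<Rightarrow> 'a) set" where
  "proper_colourings n k Q = {w \<in> coords n k \<rightarrow>\<^sub>E Q.
     \<forall>i j l. 1 \<le> i \<and> i < j \<and> j \<le> n + 1 \<and> 1 \<le> l \<and> l \<le> k \<longrightarrow> w (Xc j) \<noteq> w (Yc i l)}"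

text \<open>
  The characteristic polynomial is the chromatic polynomial of the graph, divided by the
  square of the variable because the graph has two components.
\<close>

lemma chi_homogenized_counts_colourings:
  assumes "n \<ge> 1" "k \<ge> 1"
  shows "int q ^ 2 * poly (chi_homogenized n k) (int q)
           = int (card (proper_colourings n k (real ` {..<q})))"
proof -
  have "grid n k q - \<Union>(homogenized_arrangement n k) = {v \<in> grid n k q.
      \<forall>i j l. 1 \<le> i \<and> i < j \<and> j \<le> n + 1 \<and> 1 \<le> l \<and> l \<le> k \<longrightarrow>
        shear n k v (Xc j) \<noteq> shear n k v (Yc i l)}" (is "?G = ?G'")
  proof -
    have "v \<in> ?G \<longleftrightarrow> v \<in> grid n k q \<and> (\<forall>i j l. 1 \<le> i \<and> i < j \<and> j \<le> n + 1 \<and> 1 \<le> l \<and> l \<le> k \<longrightarrow>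
        v \<notin> homogenized_hyperplane n k i j l)" for v
      by (auto simp: homogenized_arrangement_def)
    then show ?thesis
      by (intro set_eqI) (simp add: homogenized_hyperplane_eq grid_def conj_assoc cong: conj_cong)
  qed
  then have "card (grid n k q - \<Union>(homogenized_arrangement n k))
      = card (proper_colourings n k (real ` {..<q}))"
    unfolding proper_colourings_def
    using card_shear_preimage[of n k q "\<lambda>w. \<forall>i j l. 1 \<le> i \<and> i < j \<and> j \<le> n + 1 \<and> 1 \<le> l \<and> l \<le> k
        \<longrightarrow> w (Xc j) \<noteq> w (Yc i l)"] by simp
  then show ?thesis
    using char_poly_counts_complement[OF rank_drop_homogenized finite_homogenized_arrangement
        hyperplane_proper finite_grid _ card_intersection_Int_grid, of n k q]
    by (auto simp: flat_dim_center[OF assms] chi_homogenized_def grid_def)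
qed

section \<open>Counting colourings through words\<close>

text \<open>
  Given the colours \<open>xs\<close> of $x_2,\dots,x_{n+1}$, the vertex $z_i^{(l)}$ must avoid exactly the colours
  that occur in \<open>drop (i - 1) xs\<close>; the weight is the number of ways to colour all the $z_i^{(l)}$.
\<close>

definition suffix_weight :: "nat \<Rightarrow> int \<Rightarrow> 'a list \<Rightarrow> int" where
  "suffix_weight k q xs = (\<Prod>i<length xs. (q - int (card (set (drop i xs)))) ^ k)"

lemma suffix_weight_Nil [simp]: "suffix_weight k q [] = 1"
  by (simp add: suffix_weight_def)

lemma suffix_weight_Cons:
  "suffix_weight k q (x # xs) = (q - int (card (set (x # xs)))) ^ k * suffix_weight k q xs"
  by (simp add: suffix_weight_def prod.lessThan_Suc_shift del: prod.lessThan_Suc)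

text \<open>
  The edges only join an $x_j$ to a $z_i^{(l)}$.  Once the word \<open>xs\<close> of colours of
  $x_1,\dots,x_{n+1}$ is fixed, the $z_i^{(l)}$ can thus be coloured independently of each other.  The
  colour of $x_1$ restricts none of them, hence the tail.
\<close>

lemma card_proper_colourings_with_word:
  assumes "finite Q" "set xs \<subseteq> Q" "length xs = n + 1"
  shows "int (card {w \<in> proper_colourings n k Q. \<forall>j\<in>{1..n + 1}. w (Xc j) = xs ! (j - 1)})
           = suffix_weight k (int (card Q)) (tl xs)"
proof -
  \<comment> \<open>the colours that remain possible at the vertex \<open>c\<close>\<close>
  define F where "F = (\<lambda>c. case c of Xc j \<Rightarrow> {xs ! (j - 1)} | Yc i l \<Rightarrow> Q - set (drop i xs))"
  have seen: "set (drop i xs) = {xs ! (j - 1) | j. i < j \<and> j \<le> n + 1}" if "i \<le> n" for i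
  proof -
    have "set (drop i xs) = {xs ! m | m. i \<le> m \<and> m < n + 1}"
    proof (intro set_eqI iffI)
      fix x assume "x \<in> set (drop i xs)"
      then obtain m where "m < length (drop i xs)" "drop i xs ! m = x"
        by (auto simp: in_set_conv_nth)
      then show "x \<in> {xs ! m | m. i \<le> m \<and> m < n + 1}"
        using assms(3) that by (intro CollectI exI[of _ "i + m"]) auto
    next
      fix x assume "x \<in> {xs ! m | m. i \<le> m \<and> m < n + 1}"
      then obtain m where "i \<le> m" "m < n + 1" "x = xs ! m"
        by blast
      then show "x \<in> set (drop i xs)"
        using assms(3) by (auto simp: in_set_conv_nth intro!: exI[of _ "m - i"])
    qed
    also have "\<dots> = {xs ! (j - 1) | j. i < j \<and> j \<le> n + 1}"
    proof (intro set_eqI iffI)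
      fix x assume "x \<in> {xs ! m | m. i \<le> m \<and> m < n + 1}"
      then obtain m where "i \<le> m" "m < n + 1" "x = xs ! m"
        by blast
      then show "x \<in> {xs ! (j - 1) | j. i < j \<and> j \<le> n + 1}"
        by (intro CollectI exI[of _ "Suc m"]) auto
    next
      fix x assume "x \<in> {xs ! (j - 1) | j. i < j \<and> j \<le> n + 1}"
      then obtain j where "i < j" "j \<le> n + 1" "x = xs ! (j - 1)"
        by blast
      then show "x \<in> {xs ! m | m. i \<le> m \<and> m < n + 1}"
        by (intro CollectI exI[of _ "j - 1"]) auto
    qed
    finally show ?thesis .
  qed
  have FX: "F (Xc j) = {xs ! (j - 1)}" and FY: "F (Yc i l) = Q - set (drop i xs)" for i j l
    by (simp_all add: F_def)
  have nth_Q: "xs ! (j - 1) \<in> Q" if "1 \<le> j" "j \<le> n + 1" for j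
    using assms that by (auto intro!: subsetD[OF assms(2)])
  have "{w \<in> proper_colourings n k Q. \<forall>j\<in>{1..n + 1}. w (Xc j) = xs ! (j - 1)}
      = PiE (coords n k) F" (is "?L = ?R")
  proof (intro set_eqI iffI)
    fix w assume w: "w \<in> ?L"
    then have wQ: "w \<in> coords n k \<rightarrow>\<^sub>E Q"
      and wX: "\<And>j. 1 \<le> j \<Longrightarrow> j \<le> n + 1 \<Longrightarrow> w (Xc j) = xs ! (j - 1)"
      and ne: "\<And>i j l. 1 \<le> i \<Longrightarrow> i < j \<Longrightarrow> j \<le> n + 1 \<Longrightarrow> 1 \<le> l \<Longrightarrow> l \<le> k \<Longrightarrow> w (Xc j) \<noteq> w (Yc i l)"
      by (auto simp: proper_colourings_def)
    show "w \<in> ?R"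
    proof (rule PiE_I)
      fix c assume c: "c \<in> coords n k"
      show "w c \<in> F c"
      proof (cases c)
        case (Xc j)
        then show ?thesis
          using c wX by (simp add: FX)
      next
        case (Yc i l)
        then have il: "1 \<le> i" "i \<le> n" "1 \<le> l" "l \<le> k"
          using c by auto
        have "w (Yc i l) \<notin> set (drop i xs)"
        proof
          assume "w (Yc i l) \<in> set (drop i xs)"
          then obtain j where "w (Yc i l) = xs ! (j - 1)" "i < j" "j \<le> n + 1"
            using seen il by auto
          then show False
            using ne[of i j l] wX[of j] il by simp
        qed
        then show ?thesis
          using PiE_mem[OF wQ c] Yc by (simp add: FY)
      qed
    qed (use wQ in \<open>auto simp: PiE_def extensional_def\<close>)
  next
    fix w assume w: "w \<in> ?R"
    have wX: "w (Xc j) = xs ! (j - 1)" if "1 \<le> j" "j \<le> n + 1" for j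
      using PiE_mem[OF w, of "Xc j"] that by (simp add: FX)
    have wY: "w (Yc i l) \<in> Q - set (drop i xs)" if "1 \<le> i" "i \<le> n" "1 \<le> l" "l \<le> k" for i l
      using PiE_mem[OF w, of "Yc i l"] that by (simp add: FY)
    have "w \<in> coords n k \<rightarrow>\<^sub>E Q"
    proof (rule PiE_I)
      fix c assume "c \<in> coords n k"
      then show "w c \<in> Q"
        using wX wY nth_Q by (cases c) auto
    qed (use w in \<open>auto simp: PiE_def extensional_def\<close>)
    moreover have "w (Xc j) \<noteq> w (Yc i l)"
      if "1 \<le> i" "i < j" "j \<le> n + 1" "1 \<le> l" "l \<le> k" for i j l
    proof -
      have "xs ! (j - 1) \<in> set (drop i xs)"
        using that seen[of i] by auto
      then show ?thesis
        using wX[of j] wY[of i l] that by auto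
    qed
    ultimately show "w \<in> ?L"
      using wX by (simp add: proper_colourings_def)
  qed
  then have "card ?L = (\<Prod>c\<in>coords n k. card (F c))"
    by (simp add: card_PiE finite_coords)
  also have "\<dots> = (\<Prod>c\<in>Xc ` {1..n + 1}. card (F c))
      * (\<Prod>c\<in>(\<lambda>(i, l). Yc i l) ` ({1..n} \<times> {1..k}). card (F c))"
    unfolding coords_def by (rule prod.union_disjoint) auto
  also have "(\<Prod>c\<in>Xc ` {1..n + 1}. card (F c)) = 1"
    by (rule prod.neutral) (auto simp: FX)
  also have "(\<Prod>c\<in>(\<lambda>(i, l). Yc i l) ` ({1..n} \<times> {1..k}). card (F c))
      = (\<Prod>(i, l)\<in>{1..n} \<times> {1..k}. card (Q - set (drop i xs)))"
    by (subst prod.reindex) (auto simp: inj_on_def FY intro!: prod.cong)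
  also have "\<dots> = (\<Prod>i\<in>{1..n}. card (Q - set (drop i xs)) ^ k)"
    by (simp add: prod.cartesian_product[symmetric])
  also have "int (1 * \<dots>) = (\<Prod>i\<in>{1..n}. (int (card Q) - int (card (set (drop i xs)))) ^ k)"
  proof -
    have "int (card (Q - set (drop i xs))) = int (card Q) - int (card (set (drop i xs)))" for i
    proof -
      have "set (drop i xs) \<subseteq> Q"
        using assms(2) set_drop_subset[of i xs] by blast
      then show ?thesis
        using assms(1) card_mono[of Q "set (drop i xs)"] by (simp add: card_Diff_subset of_nat_diff)
    qed
    then show ?thesis
      by simp
  qed
  also have "\<dots> = (\<Prod>i<n. (int (card Q) - int (card (set (drop (Suc i) xs)))) ^ k)"
    by (rule prod.reindex_bij_witness[of _ Suc "\<lambda>i. i - 1"]) auto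
  also have "\<dots> = suffix_weight k (int (card Q)) (tl xs)"
    using assms(3) by (simp add: suffix_weight_def drop_Suc)
  finally show ?thesis .
qed

definition words :: "'a set \<Rightarrow> nat \<Rightarrow> 'a list set" where
  "words Q n = {xs. set xs \<subseteq> Q \<and> length xs = n}"

lemma finite_words: "finite Q \<Longrightarrow> finite (words Q n)"
  unfolding words_def by (rule finite_lists_length_eq)

lemma words_Suc: "words Q (Suc n) = (\<lambda>(x, xs). x # xs) ` (Q \<times> words Q n)"
  by (auto simp: words_def length_Suc_conv image_iff)

lemma sum_words_Suc: "(\<Sum>xs\<in>words Q (Suc n). f xs) = (\<Sum>xs\<in>words Q n. \<Sum>x\<in>Q. f (x # xs))"
proof -
  have "(\<Sum>xs\<in>words Q (Suc n). f xs) = (\<Sum>(x, xs)\<in>Q \<times> words Q n. f (x # xs))"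
    unfolding words_Suc by (subst sum.reindex) (auto simp: inj_on_def intro!: sum.cong)
  also have "\<dots> = (\<Sum>xs\<in>words Q n. \<Sum>x\<in>Q. f (x # xs))"
    by (simp add: sum.cartesian_product[symmetric] sum.swap[of _ Q])
  finally show ?thesis .
qed

text \<open>
  The free choice of the colour of $x_1$ gives the factor \<open>card Q\<close>.
\<close>

lemma card_proper_colourings:
  assumes "finite Q"
  shows "int (card (proper_colourings n k Q))
           = int (card Q) * (\<Sum>xs\<in>words Q n. suffix_weight k (int (card Q)) xs)"
proof -
  let ?P = "proper_colourings n k Q"
  let ?W = "\<lambda>xs. {w \<in> ?P. \<forall>j\<in>{1..n + 1}. w (Xc j) = xs ! (j - 1)}"
  have finP: "finite ?P"
    using assms by (auto simp: proper_colourings_def finite_coords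
        intro: finite_subset[OF _ finite_PiE[of "coords n k" "\<lambda>_. Q"]])
  have "?P = (\<Union>xs\<in>words Q (Suc n). ?W xs)"
  proof -
    have "\<exists>xs\<in>words Q (Suc n). w \<in> ?W xs" if w: "w \<in> ?P" for w
    proof (rule bexI[of _ "map (\<lambda>j. w (Xc (Suc j))) [0..<Suc n]"])
      have "w (Xc (Suc j)) \<in> Q" if "j < Suc n" for j
        using w that by (auto simp: proper_colourings_def intro!: PiE_mem[of w "coords n k" "\<lambda>_. Q"])
      then show "map (\<lambda>j. w (Xc (Suc j))) [0..<Suc n] \<in> words Q (Suc n)"
        by (auto simp: words_def simp del: upt_Suc)
    qed (use w in \<open>auto simp del: upt_Suc\<close>)
    then show ?thesis
      by blast
  qed
  moreover have "card (\<Union>xs\<in>words Q (Suc n). ?W xs) = (\<Sum>xs\<in>words Q (Suc n). card (?W xs))"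
  proof (rule card_UN_disjoint)
    show "\<forall>xs\<in>words Q (Suc n). \<forall>ys\<in>words Q (Suc n). xs \<noteq> ys \<longrightarrow> ?W xs \<inter> ?W ys = {}"
    proof (intro ballI impI, rule ccontr)
      fix xs ys assume len: "xs \<in> words Q (Suc n)" "ys \<in> words Q (Suc n)" and "xs \<noteq> ys"
        and "?W xs \<inter> ?W ys \<noteq> {}"
      then obtain w where w: "w \<in> ?W xs" "w \<in> ?W ys"
        by blast
      have "xs ! m = ys ! m" if "m < Suc n" for m
        using w that by (auto dest!: bspec[of _ _ "Suc m"])
      then have "xs = ys"
        using len by (intro nth_equalityI) (auto simp: words_def)
      then show False
        using \<open>xs \<noteq> ys\<close> by simp
    qed
  qed (use assms finP in \<open>auto simp: finite_words\<close>)
  ultimately have "int (card ?P) = (\<Sum>xs\<in>words Q (Suc n). int (card (?W xs)))"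
    by simp
  also have "\<dots> = (\<Sum>xs\<in>words Q (Suc n). suffix_weight k (int (card Q)) (tl xs))"
    by (intro sum.cong refl card_proper_colourings_with_word assms) (auto simp: words_def)
  also have "\<dots> = int (card Q) * (\<Sum>xs\<in>words Q n. suffix_weight k (int (card Q)) xs)"
    by (simp add: sum_words_Suc sum_distrib_left)
  finally show ?thesis .
qed

text \<open>
  Words are grouped by the number \<open>d\<close> of distinct colours because the effect of one more
  letter in front depends on the word only through this number.
\<close>

definition word_sum :: "'a set \<Rightarrow> nat \<Rightarrow> nat \<Rightarrow> nat \<Rightarrow> int" where
  "word_sum Q k n d =
     (\<Sum>xs\<in>words Q n. if card (set xs) = d then suffix_weight k (int (card Q)) xs else 0)"

lemma word_sum_0: "word_sum Q k 0 d = (if d = 0 then 1 else 0)"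
proof -
  have "words Q 0 = {[]}"
    by (auto simp: words_def)
  then show ?thesis
    by (simp add: word_sum_def)
qed

lemma word_sum_Suc_0: "word_sum Q k (Suc n) 0 = 0"
  unfolding word_sum_def by (rule sum.neutral) (auto simp: words_def card_eq_0_iff)

text \<open>
  A new letter in front either repeats one of the colours of the word or is one of the
  remaining colours.
\<close>

lemma word_sum_Suc_Suc:
  assumes "finite Q"
  shows "word_sum Q k (Suc n) (Suc d) = (int (card Q) - int (Suc d)) ^ k *
    (int (Suc d) * word_sum Q k n (Suc d) + (int (card Q) - int d) * word_sum Q k n d)"
proof -
  let ?q = "int (card Q)"
  let ?s = "suffix_weight k ?q"
  have step: "(\<Sum>x\<in>Q. if card (set (x # xs)) = Suc d then ?s (x # xs) else 0)
      = (?q - int (Suc d)) ^ k * (int (Suc d) * (if card (set xs) = Suc d then ?s xs else 0)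
          + (?q - int d) * (if card (set xs) = d then ?s xs else 0))" (is "?lhs = ?rhs")
    if xs: "xs \<in> words Q n" for xs
  proof -
    have sub: "set xs \<subseteq> Q"
      using xs by (simp add: words_def)
    have "?lhs = (\<Sum>x\<in>Q. if x \<in> set xs
        then (if card (set xs) = Suc d then (?q - int (Suc d)) ^ k * ?s xs else 0)
        else (if card (set xs) = d then (?q - int (Suc d)) ^ k * ?s xs else 0))"
      by (intro sum.cong refl) (auto simp: suffix_weight_Cons card_insert_if)
    also have "\<dots> = int (card (set xs)) *
          (if card (set xs) = Suc d then (?q - int (Suc d)) ^ k * ?s xs else 0)
        + int (card (Q - set xs)) *
          (if card (set xs) = d then (?q - int (Suc d)) ^ k * ?s xs else 0)"
    proof -
      have "Q \<inter> {x. x \<in> set xs} = set xs" "Q \<inter> - {x. x \<in> set xs} = Q - set xs"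
        using sub by auto
      then show ?thesis
        using assms by (simp add: sum.If_cases)
    qed
    also have "int (card (Q - set xs)) = ?q - int (card (set xs))"
      using sub assms card_mono[OF assms sub] by (simp add: card_Diff_subset of_nat_diff)
    finally show ?thesis
      by (auto simp: algebra_simps)
  qed
  have "word_sum Q k (Suc n) (Suc d)
      = (\<Sum>xs\<in>words Q n. \<Sum>x\<in>Q. if card (set (x # xs)) = Suc d then ?s (x # xs) else 0)"
    unfolding word_sum_def by (rule sum_words_Suc)
  also have "\<dots> = (?q - int (Suc d)) ^ k *
      (int (Suc d) * word_sum Q k n (Suc d) + (?q - int d) * word_sum Q k n d)"
    unfolding word_sum_def sum_distrib_left sum.distrib[symmetric]
    by (intro sum.cong refl step)
  finally show ?thesis .
qed

lemma sum_word_sum: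
  assumes "n \<ge> 1" "finite Q"
  shows "(\<Sum>xs\<in>words Q n. suffix_weight k (int (card Q)) xs) = (\<Sum>d=1..n. word_sum Q k n d)"
proof -
  have "(\<Sum>d=1..n. if card (set xs) = d then suffix_weight k (int (card Q)) xs else 0)
      = suffix_weight k (int (card Q)) xs" if "xs \<in> words Q n" for xs
  proof -
    have "card (set xs) \<in> {1..n}"
      using that assms card_length[of xs] by (auto simp: words_def Suc_le_eq card_gt_0_iff)
    then show ?thesis
      by simp
  qed
  then show ?thesis
    unfolding word_sum_def by (subst sum.swap) simp
qed

section \<open>Coefficients of the generating function\<close>

text \<open>
  The summands of the right-hand side.  The coefficient of $u^n$ in \<open>series_term k d\<close> is a
  polynomial whose value at \<open>q\<close>, multiplied by \<open>q\<close>, is the weighted number of words of length \<open>n\<close>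
  with exactly \<open>d\<close> of \<open>q\<close> colours.
\<close>

definition series_term :: "nat \<Rightarrow> nat \<Rightarrow> int poly fps" where
  "series_term k n =
     fps_const (falling_factorial (tvar - 1) (n - 1) * (falling_factorial (tvar - 1) n) ^ k)
       * fps_X ^ n
       * fps_recip (\<Prod>i=1..n. 1 - fps_const (of_nat i * (tvar - of_nat i) ^ k) * fps_X)"

lemma falling_factorial_Suc: "falling_factorial x (Suc n) = falling_factorial x n * (x - of_nat n)"
  by (simp add: falling_factorial_def)

lemma series_term_mult_denominator:
  "series_term k n * (\<Prod>i=1..n. 1 - fps_const (of_nat i * (tvar - of_nat i) ^ k) * fps_X)
     = fps_const (falling_factorial (tvar - 1) (n - 1) * (falling_factorial (tvar - 1) n) ^ k)
       * fps_X ^ n"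
proof -
  let ?D = "\<Prod>i=1..n. 1 - fps_const (of_nat i * (tvar - of_nat i) ^ k) * fps_X"
  have "?D * fps_recip ?D = 1"
    by (rule fps_recip[OF denominator_nth_0])
  then have "fps_recip ?D * ?D = 1"
    by (simp only: mult.commute)
  then show ?thesis
    by (simp add: series_term_def mult.assoc)
qed

lemma series_term_1:
  "series_term k 1 * (1 - fps_const ((tvar - 1) ^ k) * fps_X) = fps_const ((tvar - 1) ^ k) * fps_X"
  using series_term_mult_denominator[of k 1] by (simp add: falling_factorial_def)

text \<open>
  Two consecutive terms differ by one factor of the denominator and one new factor in each
  falling factorial.  This yields the recurrence of \<open>word_sum_Suc_Suc\<close> for the coefficients.
\<close>

lemma series_term_Suc:
  assumes "d \<ge> 1"
  shows "series_term k (Suc d)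
             * (1 - fps_const (of_nat (Suc d) * (tvar - of_nat (Suc d)) ^ k) * fps_X)
           = fps_const ((tvar - of_nat d) * (tvar - of_nat (Suc d)) ^ k) * fps_X * series_term k d"
    (is "?l * ?b = ?c * fps_X * _")
proof -
  let ?D = "\<lambda>n. \<Prod>i=1..n. 1 - fps_const (of_nat i * (tvar - of_nat i) ^ k) * fps_X"
  obtain e where e: "d = Suc e"
    using assms by (cases d) auto
  have "(?l * ?b) * ?D d = ?l * ?D (Suc d)"
    by (simp add: mult_ac del: of_nat_Suc)
  also have "\<dots> = fps_const (falling_factorial (tvar - 1) d * (falling_factorial (tvar - 1) (Suc d)) ^ k)
       * fps_X ^ Suc d"
    using series_term_mult_denominator[of k "Suc d"] by simp
  also have "\<dots> = ?c * fps_X * (series_term k d * ?D d)"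
  proof -
    have ff: "falling_factorial (tvar - 1) d = falling_factorial (tvar - 1) (d - 1) * (tvar - of_nat d)"
      "falling_factorial (tvar - 1) (Suc d) = falling_factorial (tvar - 1) d * (tvar - of_nat (Suc d))"
      by (simp_all add: e falling_factorial_Suc algebra_simps)
    have "falling_factorial (tvar - 1) d * (falling_factorial (tvar - 1) (Suc d)) ^ k
        = (tvar - of_nat d) * (tvar - of_nat (Suc d)) ^ k
          * (falling_factorial (tvar - 1) (d - 1) * (falling_factorial (tvar - 1) d) ^ k)"
      unfolding ff(2) unfolding power_mult_distrib
      by (subst ff(1)) (simp only: mult_ac)
    then show ?thesis
      unfolding series_term_mult_denominator
      by (simp only: fps_const_mult[symmetric] power_Suc mult_ac)
  qed
  finally have "(?l * ?b) * ?D d = (?c * fps_X * series_term k d) * ?D d"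
    by (simp only: mult.assoc)
  moreover have "?D d \<noteq> 0"
  proof
    assume "?D d = 0"
    then have "fps_nth (?D d) 0 = 0"
      by (simp only: fps_zero_nth)
    then show False
      by (simp only: denominator_nth_0)
  qed
  ultimately show ?thesis
    by (rule mult_right_cancel[THEN iffD1, rotated])
qed

lemma series_term_coeff_less: "m < n \<Longrightarrow> fps_nth (series_term k n) m = 0"
  by (simp add: series_term_def mult.assoc fps_X_power_mult_nth)

lemma coeff_Suc_of_recursion:
  fixes f g :: "'a::comm_ring_1 fps"
  assumes "f * (1 - fps_const a * fps_X) = fps_const b * fps_X * g"
  shows "fps_nth f (Suc n) = a * fps_nth f n + b * fps_nth g n"
proof -
  have "f = fps_const a * (fps_X * f) + fps_const b * (fps_X * g)"
    using assms by (simp add: algebra_simps)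
  then have "fps_nth f (Suc n)
      = fps_nth (fps_const a * (fps_X * f) + fps_const b * (fps_X * g)) (Suc n)"
    by simp
  then show ?thesis
    by simp
qed

text \<open>
  Both sides satisfy the same recurrence.  The term for a single colour is treated apart:
  its words grow out of the empty word, to which no term of the series corresponds.
\<close>

lemma word_sum_eq_series_coeff:
  assumes "finite Q"
  shows "word_sum Q k n (Suc d)
           = int (card Q) * poly (fps_nth (series_term k (Suc d)) n) (int (card Q))"
proof (induction n arbitrary: d)
  case 0
  then show ?case
    by (simp add: word_sum_0 series_term_coeff_less)
next
  case (Suc n)
  show ?case
  proof (cases d)
    case 0
    have rec: "fps_nth (series_term k 1) (Suc n)
        = (tvar - 1) ^ k * fps_nth (series_term k 1) n + (tvar - 1) ^ k * fps_nth 1 n"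
      by (rule coeff_Suc_of_recursion) (use series_term_1 in simp)
    \<comment> \<open>the empty word contributes at \<open>n = 0\<close> only, like the coefficients of the series 1\<close>
    have zero: "word_sum Q k n 0 = (if n = 0 then 1 else 0)"
      by (cases n) (simp_all add: word_sum_0 word_sum_Suc_0)
    show ?thesis
      using rec Suc.IH[of 0] by (simp add: 0 word_sum_Suc_Suc[OF assms] zero algebra_simps)
  next
    case (Suc e)
    have rec: "fps_nth (series_term k (Suc d)) (Suc n)
        = of_nat (Suc d) * (tvar - of_nat (Suc d)) ^ k * fps_nth (series_term k (Suc d)) n
          + (tvar - of_nat d) * (tvar - of_nat (Suc d)) ^ k * fps_nth (series_term k d) n"
      by (rule coeff_Suc_of_recursion, rule series_term_Suc) (simp add: Suc)
    have "poly (of_nat m) x = of_nat m" for m and x :: int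
      by (simp add: of_nat_poly)
    then show ?thesis
      using Suc.IH[of d] Suc.IH[of e]
      by (simp add: rec word_sum_Suc_Suc[OF assms] algebra_simps flip: Suc del: of_nat_Suc)
  qed
qed

text \<open>
  Both sides are polynomials that agree at every positive integer \<open>q\<close>.
\<close>

lemma chi_homogenized_eq_sum:
  assumes "n \<ge> 1" "k \<ge> 1"
  shows "chi_homogenized n k = (\<Sum>d=1..n. fps_nth (series_term k d) n)"
proof (rule ccontr)
  let ?p = "chi_homogenized n k - (\<Sum>d=1..n. fps_nth (series_term k d) n)"
  assume "\<not> ?thesis"
  then have "finite {x. poly ?p x = 0}"
    by (intro poly_roots_finite) simp
  moreover have "poly ?p (int q) = 0" if "q \<ge> 1" for q
  proof -
    let ?Q = "real ` {..<q}"
    have Q: "finite ?Q" "card ?Q = q"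
      by (simp_all add: card_image)
    have "word_sum ?Q k n d = int q * poly (fps_nth (series_term k d) n) (int q)"
      if "d \<in> {1..n}" for d
      using word_sum_eq_series_coeff[OF Q(1), of k n "d - 1"] Q(2) that by simp
    then have "(\<Sum>d=1..n. word_sum ?Q k n d)
        = int q * poly (\<Sum>d=1..n. fps_nth (series_term k d) n) (int q)"
      by (simp add: poly_sum sum_distrib_left)
    then have "int q ^ 2 * poly (chi_homogenized n k) (int q)
        = int q ^ 2 * poly (\<Sum>d=1..n. fps_nth (series_term k d) n) (int q)"
      unfolding chi_homogenized_counts_colourings[OF assms] card_proper_colourings[OF Q(1)]
      by (simp only: sum_word_sum[OF assms(1) Q(1), of k, unfolded Q(2)] Q(2) power2_eq_square
          mult.assoc)
    then show ?thesis
      using that by simp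
  qed
  then have "int ` {1..} \<subseteq> {x. poly ?p x = 0}"
    by auto
  moreover have "infinite (int ` {1..})"
    by (simp add: finite_image_iff infinite_Ici)
  ultimately show False
    by (meson finite_subset)
qed

theorem corollary5p3:
  fixes k :: nat
  assumes "k \<ge> 1"
  shows "(\<lambda>m. let n = Suc m in
            fps_const (falling_factorial (tvar - 1) (n - 1) * (falling_factorial (tvar - 1) n) ^ k)
              * fps_X ^ n
              * fps_recip (\<Prod>i=1..n. 1 - fps_const (of_nat i * (tvar - of_nat i) ^ k) * fps_X))
         sums Abs_fps (\<lambda>n. if n \<ge> 1 then chi_homogenized n k else 0)"
  unfolding Let_def series_term_def[symmetric] sums_def
proof (rule tendsto_fpsI)
  fix n
  \<comment> \<open>only the terms with index at most \<open>n\<close> contribute to the coefficient of $u^n$\<close>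
  have "fps_nth (\<Sum>m<M. series_term k (Suc m)) n = (if n \<ge> 1 then chi_homogenized n k else 0)"
    if "M \<ge> n" for M
  proof -
    have "fps_nth (\<Sum>m<M. series_term k (Suc m)) n = (\<Sum>m<M. fps_nth (series_term k (Suc m)) n)"
      by (rule fps_sum_nth)
    also have "\<dots> = (\<Sum>d=1..M. fps_nth (series_term k d) n)"
      by (rule sum.reindex_bij_witness[of _ "\<lambda>d. d - 1" Suc]) auto
    also have "\<dots> = (\<Sum>d=1..n. fps_nth (series_term k d) n)"
      using that by (intro sum.mono_neutral_right) (auto simp: series_term_coeff_less)
    also have "\<dots> = (if n \<ge> 1 then chi_homogenized n k else 0)"
      using assms by (simp add: chi_homogenized_eq_sum)
    finally show ?thesis .
  qed
  then show "\<forall>\<^sub>F M in sequentially. fps_nth (\<Sum>m<M. series_term k (Suc m)) n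
      = fps_nth (Abs_fps (\<lambda>n. if n \<ge> 1 then chi_homogenized n k else 0)) n"
    unfolding fps_nth_Abs_fps by (intro eventually_sequentiallyI[of n])
qed

end
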